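(* Let $n\equiv 2\pmod 4$ with $n>2$. Then the ensemble of any $\mathrm{OA}(n+1,n)$ contains at least two Latin squares that are not isotopic to each other.
   Context: An orthogonal array $\mathrm{OA}(k,n)$ on an alphabet $\Lambda$ with $|\Lambda|=n$ is an $n^2\times k$ matrix $A=(a_{r\ell})$ with entries in $\Lambda$ such that in every pair of distinct columns each ordered pair in $\Lambda^2$ occurs in exactly one row. The ensemble of $A$ consists of the Latin squares obtained from each of the $\binom{k}{3}$ choices of columns $i<j<\ell$ of $A$: the Latin square for $i<j<\ell$ has rows and columns indexed by $\Lambda$, and for each row $r$ of $A$ its entry in row $a_{ri}$, column $a_{rj}$ is $a_{r\ell}$. Two Latin squares on $\Lambda$ are isotopic if one can be obtained from the other by permuting rows, permuting columns and permuting symbols (by three arbitrary permutations of $\Lambda$). *)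

theory Defs
  imports
    "Jordan_Normal_Form.Matrix"
    "HOL-Combinatorics.Permutations"
    "HOL-Number_Theory.Cong"
begin

definition orthogonal_array :: "'a set \<Rightarrow> nat \<Rightarrow> nat \<Rightarrow> 'a mat \<Rightarrow> bool" where
  "orthogonal_array \<Lambda> k n A \<longleftrightarrow>
     finite \<Lambda> \<and> card \<Lambda> = n \<and>
     A \<in> carrier_mat (n\<^sup>2) k \<and> elements_mat A \<subseteq> \<Lambda> \<and>
     (\<forall>i<k. \<forall>j<k. i \<noteq> j \<longrightarrow>
        (\<forall>x\<in>\<Lambda>. \<forall>y\<in>\<Lambda>. \<exists>!r. r < n\<^sup>2 \<and> A $$ (r, i) = x \<and> A $$ (r, j) = y))"

text \<open>
  A square on \<open>\<Lambda>\<close> is a function \<open>L\<close> giving the entry \<open>L x y\<close> in row \<open>x\<close> and column \<open>y\<close>;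
  only its values for \<open>x\<close> and \<open>y\<close> in \<open>\<Lambda>\<close> matter.
\<close>

definition latin_square :: "'a set \<Rightarrow> ('a \<Rightarrow> 'a \<Rightarrow> 'a) \<Rightarrow> bool" where
  "latin_square \<Lambda> L \<longleftrightarrow>
     (\<forall>x\<in>\<Lambda>. bij_betw (\<lambda>y. L x y) \<Lambda> \<Lambda>) \<and> (\<forall>y\<in>\<Lambda>. bij_betw (\<lambda>x. L x y) \<Lambda> \<Lambda>)"

definition isotopic :: "'a set \<Rightarrow> ('a \<Rightarrow> 'a \<Rightarrow> 'a) \<Rightarrow> ('a \<Rightarrow> 'a \<Rightarrow> 'a) \<Rightarrow> bool" where
  "isotopic \<Lambda> L M \<longleftrightarrow>
     (\<exists>\<alpha> \<beta> \<gamma>. \<alpha> permutes \<Lambda> \<and> \<beta> permutes \<Lambda> \<and> \<gamma> permutes \<Lambda> \<and>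
        (\<forall>x\<in>\<Lambda>. \<forall>y\<in>\<Lambda>. M (\<alpha> x) (\<beta> y) = \<gamma> (L x y)))"

text \<open>
  In an orthogonal array, for \<open>i \<noteq> j\<close> and \<open>x\<close>, \<open>y\<close> in the alphabet, the row selected by the
  definite description below exists and is unique.
\<close>

definition column_square :: "'a mat \<Rightarrow> nat \<Rightarrow> nat \<Rightarrow> nat \<Rightarrow> 'a \<Rightarrow> 'a \<Rightarrow> 'a" where
  "column_square A i j l x y =
     A $$ (THE r. r < dim_row A \<and> A $$ (r, i) = x \<and> A $$ (r, j) = y, l)"

definition ensemble :: "'a mat \<Rightarrow> ('a \<Rightarrow> 'a \<Rightarrow> 'a) set" where
  "ensemble A = {column_square A i j l | i j l. i < j \<and> j < l \<and> l < dim_col A}"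

lemma orthogonal_array_entry:
  assumes "orthogonal_array \<Lambda> k n A" and "r < n\<^sup>2" and "i < k"
  shows "A $$ (r, i) \<in> \<Lambda>"
proof -
  have "A $$ (r, i) \<in> elements_mat A"
    by (rule elements_matI[of A "n\<^sup>2" k r i]) (use assms in \<open>simp_all add: orthogonal_array_def\<close>)
  then show ?thesis using assms(1) unfolding orthogonal_array_def by blast
qed

lemma orthogonal_array_ex1:
  assumes "orthogonal_array \<Lambda> k n A" and "i < k" and "j < k" and "i \<noteq> j"
    and "x \<in> \<Lambda>" and "y \<in> \<Lambda>"
  shows "\<exists>!r. r < n\<^sup>2 \<and> A $$ (r, i) = x \<and> A $$ (r, j) = y"
  using assms by (simp add: orthogonal_array_def)

lemma orthogonal_array_row_eq:
  assumes OA: "orthogonal_array \<Lambda> k n A" and ij: "i < k" "j < k" "i \<noteq> j"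
    and rs: "r < n\<^sup>2" "s < n\<^sup>2"
    and eq: "A $$ (r, i) = A $$ (s, i)" "A $$ (r, j) = A $$ (s, j)"
  shows "r = s"
proof -
  have "\<exists>!t. t < n\<^sup>2 \<and> A $$ (t, i) = A $$ (r, i) \<and> A $$ (t, j) = A $$ (r, j)"
    by (intro orthogonal_array_ex1[OF OA ij] orthogonal_array_entry[OF OA] rs ij)
  then show ?thesis using rs eq by metis
qed

lemma column_square_eq:
  assumes OA: "orthogonal_array \<Lambda> k n A" and ij: "i < k" "j < k" "i \<noteq> j" and r: "r < n\<^sup>2"
  shows "column_square A i j l (A $$ (r, i)) (A $$ (r, j)) = A $$ (r, l)"
proof -
  have d: "dim_row A = n\<^sup>2" using OA by (auto simp: orthogonal_array_def)
  have "(THE s. s < n\<^sup>2 \<and> A $$ (s, i) = A $$ (r, i) \<and> A $$ (s, j) = A $$ (r, j)) = r"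
  proof (rule the_equality)
    show "r < n\<^sup>2 \<and> A $$ (r, i) = A $$ (r, i) \<and> A $$ (r, j) = A $$ (r, j)" using r by blast
    show "s = r" if "s < n\<^sup>2 \<and> A $$ (s, i) = A $$ (r, i) \<and> A $$ (s, j) = A $$ (r, j)" for s
      using orthogonal_array_row_eq[OF OA ij, of s r] that r by blast
  qed
  then show ?thesis by (simp only: column_square_def d)
qed

lemma latin_square_ensemble:
  assumes OA: "orthogonal_array \<Lambda> k n A" and L: "L \<in> ensemble A"
  shows "latin_square \<Lambda> L"
proof -
  have d: "dim_col A = k" and fin: "finite \<Lambda>"
    using OA by (auto simp: orthogonal_array_def)
  obtain i j l where L_eq: "L = column_square A i j l" and lt: "i < j" "j < l" "l < k"
    using L unfolding ensemble_def d by blast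
  have ks: "i < k" "j < k" "i \<noteq> j" "l \<noteq> i" "l \<noteq> j" using lt by auto
  have ex: "\<exists>r<n\<^sup>2. A $$ (r, i) = x \<and> A $$ (r, j) = y" if "x \<in> \<Lambda>" "y \<in> \<Lambda>" for x y
    using orthogonal_array_ex1[OF OA ks(1-3) that] by blast
  have val: "L (A $$ (r, i)) (A $$ (r, j)) = A $$ (r, l)" if "r < n\<^sup>2" for r
    unfolding L_eq by (rule column_square_eq[OF OA ks(1-3) that])
  have closed: "L x y \<in> \<Lambda>" if xy: "x \<in> \<Lambda>" "y \<in> \<Lambda>" for x y
  proof -
    obtain r where r: "r < n\<^sup>2" "A $$ (r, i) = x" "A $$ (r, j) = y" using ex[OF xy] by blast
    then have "L x y = A $$ (r, l)" using val[of r] by simp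
    then show ?thesis using orthogonal_array_entry[OF OA r(1) lt(3)] by simp
  qed
  have row: "y = y'" if "x \<in> \<Lambda>" "y \<in> \<Lambda>" "y' \<in> \<Lambda>" "L x y = L x y'" for x y y'
  proof -
    obtain r where r: "r < n\<^sup>2" "A $$ (r, i) = x" "A $$ (r, j) = y" using ex \<open>x \<in> \<Lambda>\<close> \<open>y \<in> \<Lambda>\<close> by blast
    obtain s where s: "s < n\<^sup>2" "A $$ (s, i) = x" "A $$ (s, j) = y'" using ex \<open>x \<in> \<Lambda>\<close> \<open>y' \<in> \<Lambda>\<close> by blast
    have "r = s" using orthogonal_array_row_eq[OF OA lt(3) ks(1) ks(4) r(1) s(1)]
        val[OF r(1)] val[OF s(1)] r s that(4) by simp
    then show ?thesis using r s by simp
  qed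
  have col: "x = x'" if "x \<in> \<Lambda>" "x' \<in> \<Lambda>" "y \<in> \<Lambda>" "L x y = L x' y" for x x' y
  proof -
    obtain r where r: "r < n\<^sup>2" "A $$ (r, i) = x" "A $$ (r, j) = y" using ex \<open>x \<in> \<Lambda>\<close> \<open>y \<in> \<Lambda>\<close> by blast
    obtain s where s: "s < n\<^sup>2" "A $$ (s, i) = x'" "A $$ (s, j) = y" using ex \<open>x' \<in> \<Lambda>\<close> \<open>y \<in> \<Lambda>\<close> by blast
    have "r = s" using orthogonal_array_row_eq[OF OA lt(3) ks(2) ks(5) r(1) s(1)]
        val[OF r(1)] val[OF s(1)] r s that(4) by simp
    then show ?thesis using r s by simp
  qed
  have "bij_betw (\<lambda>y. L x y) \<Lambda> \<Lambda>" if "x \<in> \<Lambda>" for x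
  proof -
    have "inj_on (\<lambda>y. L x y) \<Lambda>" by (rule inj_onI) (rule row[OF that])
    then show ?thesis
      unfolding bij_betw_def using endo_inj_surj[OF fin, of "\<lambda>y. L x y"] closed[OF that] by blast
  qed
  moreover have "bij_betw (\<lambda>x. L x y) \<Lambda> \<Lambda>" if "y \<in> \<Lambda>" for y
  proof -
    have "inj_on (\<lambda>x. L x y) \<Lambda>" by (rule inj_onI) (rule col[OF _ _ that])
    then show ?thesis
      unfolding bij_betw_def using endo_inj_surj[OF fin, of "\<lambda>x. L x y"] closed[OF _ that] by blast
  qed
  ultimately show ?thesis by (simp add: latin_square_def)
qed

end

theory Submission
  imports Defs
begin

text \<open>
  For even \<open>n\<close> the product \<open>symbol_sign\<close> of the signs of the permutations \<open>x \<mapsto> y\<close>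
  determined by \<open>L x y = z\<close>, taken over all symbols \<open>z\<close>, is an isotopy invariant. Suppose it
  has the same value \<open>c\<close> on the whole ensemble. For the columns \<open>0, 1, 2\<close> seen from column
  \<open>3\<close> these permutations compose, so \<open>c = c * c\<close> and \<open>c = 1\<close>. On the other hand two rows of a
  complete array that differ in columns \<open>0\<close> and \<open>1\<close> agree in exactly one further column.
  Counting inversions, the product of the invariants of the squares from columns \<open>0 < 1 < l\<close>
  over all \<open>l\<close> is therefore \<open>(-1) ^ (m * m)\<close> with \<open>m = n choose 2\<close>, which is \<open>-1\<close> as
  \<open>n \<equiv> 2\<close> modulo \<open>4\<close>.
\<close>

section \<open>Signs of permutations via inversions\<close>

definition ordered_pairs :: "('a \<Rightarrow> int) \<Rightarrow> 'a set \<Rightarrow> ('a \<times> 'a) set" where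
  "ordered_pairs h \<Lambda> = {(x, y) \<in> \<Lambda> \<times> \<Lambda>. h x < h y}"

text \<open>
  The alphabet carries no order, so inversions are counted with respect to an injection \<open>h\<close>
  into the integers.
\<close>

definition perm_sign :: "('a \<Rightarrow> int) \<Rightarrow> 'a set \<Rightarrow> ('a \<Rightarrow> 'a) \<Rightarrow> int" where
  "perm_sign h \<Lambda> f = (\<Prod>(x, y)\<in>ordered_pairs h \<Lambda>. sgn (h (f y) - h (f x)))"

definition symbol_sign :: "('a \<Rightarrow> int) \<Rightarrow> 'a set \<Rightarrow> ('a \<Rightarrow> 'a \<Rightarrow> 'a) \<Rightarrow> int" where
  "symbol_sign h \<Lambda> L = (\<Prod>z\<in>\<Lambda>. perm_sign h \<Lambda> (\<lambda>x. inv_into \<Lambda> (L x) z))"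

lemma finite_ordered_pairs: "finite \<Lambda> \<Longrightarrow> finite (ordered_pairs h \<Lambda>)"
  by (rule finite_subset[of _ "\<Lambda> \<times> \<Lambda>"]) (auto simp: ordered_pairs_def)

text \<open>With \<open>h\<close> injective, \<open>ordered_pairs\<close> holds one representative
  of each two-element subset. A bijection permutes these subsets, and the symmetry of
  \<open>F\<close> makes the choice of representative irrelevant.\<close>

lemma prod_ordered_pairs_reindex:
  fixes F :: "'a \<Rightarrow> 'a \<Rightarrow> 'b::comm_monoid_mult"
  assumes fin: "finite \<Lambda>" and h: "inj_on h \<Lambda>" and f: "bij_betw f \<Lambda> \<Lambda>"
    and sym: "\<And>x y. F x y = F y x"
  shows "(\<Prod>(x, y)\<in>ordered_pairs h \<Lambda>. F (f x) (f y)) = (\<Prod>(x, y)\<in>ordered_pairs h \<Lambda>. F x y)"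
proof -
  \<comment> \<open>\<open>p\<close> applies \<open>f\<close> to both components and then restores
    the order required by \<open>h\<close>.\<close>
  define p where "p = (\<lambda>(x, y). if h (f x) < h (f y) then (f x, f y) else (f y, f x))"
  have mem: "f x \<in> \<Lambda>" if "x \<in> \<Lambda>" for x using f that by (auto simp: bij_betw_def)
  have f_eq: "f x = f y \<longleftrightarrow> x = y" if "x \<in> \<Lambda>" "y \<in> \<Lambda>" for x y
    using f that by (auto simp: bij_betw_def inj_on_def)
  have neq: "h (f x) \<noteq> h (f y)" if "(x, y) \<in> ordered_pairs h \<Lambda>" for x y
    using that f_eq[of x y] mem h by (auto simp: ordered_pairs_def inj_on_def)
  have "p ` ordered_pairs h \<Lambda> \<subseteq> ordered_pairs h \<Lambda>"
    using mem neq by (fastforce simp: p_def ordered_pairs_def)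
  moreover have "inj_on p (ordered_pairs h \<Lambda>)"
    by (rule inj_onI) (auto simp: p_def ordered_pairs_def f_eq split: if_splits)
  ultimately have "bij_betw p (ordered_pairs h \<Lambda>) (ordered_pairs h \<Lambda>)"
    using endo_inj_surj[OF finite_ordered_pairs[OF fin], of p h] by (auto simp: bij_betw_def)
  then have "(\<Prod>q\<in>ordered_pairs h \<Lambda>. case_prod F (p q)) = (\<Prod>q\<in>ordered_pairs h \<Lambda>. case_prod F q)"
    by (rule prod.reindex_bij_betw)
  moreover have "case_prod F (p q) = (case q of (x, y) \<Rightarrow> F (f x) (f y))" for q
    using sym by (auto simp: p_def split: prod.split)
  ultimately show ?thesis by simp
qed

lemma perm_sign_cong:
  assumes "\<And>x. x \<in> \<Lambda> \<Longrightarrow> f x = g x"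
  shows "perm_sign h \<Lambda> f = perm_sign h \<Lambda> g"
  unfolding perm_sign_def by (rule prod.cong) (auto simp: ordered_pairs_def assms)

lemma sgn_diff_square:
  fixes h :: "'a \<Rightarrow> int"
  assumes "inj_on h \<Lambda>" "x \<in> \<Lambda>" "y \<in> \<Lambda>" "x \<noteq> y"
  shows "sgn (h y - h x) * sgn (h y - h x) = 1"
  using assms by (auto simp: inj_on_def sgn_if)

lemma perm_sign_square:
  assumes h: "inj_on h \<Lambda>" and f: "bij_betw f \<Lambda> \<Lambda>"
  shows "perm_sign h \<Lambda> f * perm_sign h \<Lambda> f = 1"
proof -
  have "f x \<in> \<Lambda> \<and> f y \<in> \<Lambda> \<and> f x \<noteq> f y" if "(x, y) \<in> ordered_pairs h \<Lambda>" for x y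
    using f that by (auto simp: bij_betw_def inj_on_def ordered_pairs_def)
  then show ?thesis
    unfolding perm_sign_def prod.distrib[symmetric]
    using sgn_diff_square[OF h] by (intro prod.neutral) fastforce
qed

text \<open>Multiplicativity: the sign of \<open>g\<close> can be computed on the pairs
  \<open>(f x, f y)\<close>, provided each factor is first made symmetric, so that it belongs to an
  unordered pair.\<close>

lemma perm_sign_comp:
  assumes fin: "finite \<Lambda>" and h: "inj_on h \<Lambda>" and f: "bij_betw f \<Lambda> \<Lambda>" and g: "bij_betw g \<Lambda> \<Lambda>"
  shows "perm_sign h \<Lambda> (\<lambda>x. g (f x)) = perm_sign h \<Lambda> g * perm_sign h \<Lambda> f"
proof -
  \<comment> \<open>Both factors change sign when \<open>x\<close> and \<open>y\<close> are
    exchanged, so \<open>F\<close> is symmetric. The second factor is 1 on ordered pairs; after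
    moving to \<open>(f x, f y)\<close> it is the factor of \<open>f\<close> and cancels against
    it.\<close>
  define F where "F x y = sgn (h (g y) - h (g x)) * sgn (h y - h x)" for x y
  have sym: "F x y = F y x" for x y
    by (auto simp: F_def sgn_if)
  have "perm_sign h \<Lambda> g = (\<Prod>(x, y)\<in>ordered_pairs h \<Lambda>. F x y)"
    unfolding perm_sign_def by (rule prod.cong) (auto simp: F_def ordered_pairs_def)
  also have "\<dots> = (\<Prod>(x, y)\<in>ordered_pairs h \<Lambda>. F (f x) (f y))"
    by (rule prod_ordered_pairs_reindex[OF fin h f sym, symmetric])
  finally have "perm_sign h \<Lambda> g * perm_sign h \<Lambda> f =
      (\<Prod>(x, y)\<in>ordered_pairs h \<Lambda>. F (f x) (f y) * sgn (h (f y) - h (f x)))"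
    by (simp add: perm_sign_def prod.distrib case_prod_unfold)
  also have "\<dots> = perm_sign h \<Lambda> (\<lambda>x. g (f x))"
    unfolding perm_sign_def
  proof (rule prod.cong[OF refl], clarify)
    fix x y assume xy: "(x, y) \<in> ordered_pairs h \<Lambda>"
    then have "f x \<in> \<Lambda>" "f y \<in> \<Lambda>" "f x \<noteq> f y"
      using f by (auto simp: bij_betw_def inj_on_def ordered_pairs_def)
    then show "F (f x) (f y) * sgn (h (f y) - h (f x)) = sgn (h (g (f y)) - h (g (f x)))"
      using sgn_diff_square[OF h, of "f x" "f y"] by (simp add: F_def mult.assoc)
  qed
  finally show ?thesis by simp
qed

section \<open>Symbol permutations of a Latin square and isotopy\<close>

lemma latin_square_inv:
  assumes "latin_square \<Lambda> L" "x \<in> \<Lambda>" "z \<in> \<Lambda>"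
  shows "inv_into \<Lambda> (L x) z \<in> \<Lambda>" "L x (inv_into \<Lambda> (L x) z) = z"
proof -
  have "z \<in> L x ` \<Lambda>" using assms by (auto simp: latin_square_def bij_betw_def)
  then show "inv_into \<Lambda> (L x) z \<in> \<Lambda>" "L x (inv_into \<Lambda> (L x) z) = z"
    by (auto intro: inv_into_into f_inv_into_f)
qed

lemma latin_square_inv_eq:
  assumes "latin_square \<Lambda> L" "x \<in> \<Lambda>" "y \<in> \<Lambda>" "L x y = z"
  shows "inv_into \<Lambda> (L x) z = y"
  using assms inv_into_f_f[of "L x" \<Lambda> y] by (auto simp: latin_square_def bij_betw_def)

text \<open>A symbol cannot stand twice in the same column, so different rows carry it in different
  columns; finiteness turns injectivity into bijectivity.\<close>

lemma latin_square_symbol_bij: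
  assumes fin: "finite \<Lambda>" and L: "latin_square \<Lambda> L" and z: "z \<in> \<Lambda>"
  shows "bij_betw (\<lambda>x. inv_into \<Lambda> (L x) z) \<Lambda> \<Lambda>"
proof -
  let ?s = "\<lambda>x. inv_into \<Lambda> (L x) z"
  have "inj_on ?s \<Lambda>"
  proof (rule inj_onI)
    fix x y assume xy: "x \<in> \<Lambda>" "y \<in> \<Lambda>" "?s x = ?s y"
    then have "L x (?s x) = L y (?s x)" "?s x \<in> \<Lambda>"
      using latin_square_inv[OF L _ z] by metis+
    then show "x = y"
      using L xy(1,2) by (auto simp: latin_square_def bij_betw_def inj_on_def)
  qed
  moreover have "?s ` \<Lambda> \<subseteq> \<Lambda>" using latin_square_inv[OF L _ z] by auto
  ultimately show ?thesis using endo_inj_surj[OF fin] by (auto simp: bij_betw_def)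
qed

lemma symbol_sign_square:
  assumes "finite \<Lambda>" "inj_on h \<Lambda>" "latin_square \<Lambda> L"
  shows "symbol_sign h \<Lambda> L * symbol_sign h \<Lambda> L = 1"
  unfolding symbol_sign_def prod.distrib[symmetric]
  by (intro prod.neutral ballI perm_sign_square latin_square_symbol_bij assms)

text \<open>If \<open>s\<close> and \<open>t\<close> are the permutations of symbol \<open>z\<close>
  in \<open>L\<close> and of \<open>\<gamma> z\<close> in \<open>M\<close>, then \<open>t\<close>
  after \<open>\<alpha>\<close> equals \<open>\<beta>\<close> after \<open>s\<close>. The signs of
  \<open>\<alpha>\<close> and \<open>\<beta>\<close> thus enter once per symbol and vanish because
  the number of symbols is even.\<close>

lemma symbol_sign_isotopic:
  assumes fin: "finite \<Lambda>" and h: "inj_on h \<Lambda>" and ev: "even (card \<Lambda>)"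
    and L: "latin_square \<Lambda> L" and M: "latin_square \<Lambda> M" and iso: "isotopic \<Lambda> L M"
  shows "symbol_sign h \<Lambda> M = symbol_sign h \<Lambda> L"
proof -
  let ?s = "perm_sign h \<Lambda>"
  obtain \<alpha> \<beta> \<gamma> where perm: "\<alpha> permutes \<Lambda>" "\<beta> permutes \<Lambda>" "\<gamma> permutes \<Lambda>"
    and eq: "\<And>x y. x \<in> \<Lambda> \<Longrightarrow> y \<in> \<Lambda> \<Longrightarrow> M (\<alpha> x) (\<beta> y) = \<gamma> (L x y)"
    using iso unfolding isotopic_def by blast
  have bij: "bij_betw \<alpha> \<Lambda> \<Lambda>" "bij_betw \<beta> \<Lambda> \<Lambda>" "bij_betw \<gamma> \<Lambda> \<Lambda>"
    using perm by (auto intro: permutes_imp_bij)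
  have one: "?s f ^ card \<Lambda> = 1" if "bij_betw f \<Lambda> \<Lambda>" for f
    using perm_sign_square[OF h that] ev by (auto elim!: evenE simp: power_mult power2_eq_square)
  have "?s (\<lambda>x. inv_into \<Lambda> (M x) (\<gamma> z)) * ?s \<alpha> = ?s \<beta> * ?s (\<lambda>x. inv_into \<Lambda> (L x) z)"
    if z: "z \<in> \<Lambda>" for z
  proof -
    have gz: "\<gamma> z \<in> \<Lambda>" using perm(3) z by (simp add: permutes_in_image)
    have "inv_into \<Lambda> (M (\<alpha> x)) (\<gamma> z) = \<beta> (inv_into \<Lambda> (L x) z)" if x: "x \<in> \<Lambda>" for x
      using eq[OF x latin_square_inv(1)[OF L x z]] latin_square_inv[OF L x z] perm x
      by (intro latin_square_inv_eq[OF M]) (simp_all add: permutes_in_image)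
    then show ?thesis
      unfolding perm_sign_comp[OF fin h bij(1) latin_square_symbol_bij[OF fin M gz], symmetric]
        perm_sign_comp[OF fin h latin_square_symbol_bij[OF fin L z] bij(2), symmetric]
      by (rule perm_sign_cong)
  qed
  then have "(\<Prod>z\<in>\<Lambda>. ?s (\<lambda>x. inv_into \<Lambda> (M x) (\<gamma> z)) * ?s \<alpha>) =
      (\<Prod>z\<in>\<Lambda>. ?s \<beta> * ?s (\<lambda>x. inv_into \<Lambda> (L x) z))"
    by (rule prod.cong[OF refl])
  then have "(\<Prod>z\<in>\<Lambda>. ?s (\<lambda>x. inv_into \<Lambda> (M x) (\<gamma> z))) = symbol_sign h \<Lambda> L"
    by (simp add: prod.distrib one bij symbol_sign_def)
  \<comment> \<open>\<open>\<gamma>\<close> merely permutes the factors of the product over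
    symbols.\<close>
  then show ?thesis
    using prod.reindex_bij_betw[OF bij(3), of "\<lambda>z. ?s (\<lambda>x. inv_into \<Lambda> (M x) z)"]
    by (simp add: symbol_sign_def)
qed

section \<open>Symbol permutations inside an orthogonal array\<close>

text \<open>Lets symbol permutations be read off the array: among the rows with \<open>z\<close> in
  column \<open>l\<close>, the permutation of \<open>z\<close> takes the entry in column
  \<open>i\<close> to the entry in column \<open>j\<close>.\<close>

lemma column_square_inv:
  assumes OA: "orthogonal_array \<Lambda> k n A" and lt: "i < j" "j < l" "l < k" and r: "r < n\<^sup>2"
  shows "inv_into \<Lambda> (column_square A i j l (A $$ (r, i))) (A $$ (r, l)) = A $$ (r, j)"
proof (rule latin_square_inv_eq)
  show "latin_square \<Lambda> (column_square A i j l)"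
    using OA lt by (intro latin_square_ensemble[OF OA]) (auto simp: ensemble_def orthogonal_array_def)
  show "A $$ (r, i) \<in> \<Lambda>" "A $$ (r, j) \<in> \<Lambda>"
    using orthogonal_array_entry[OF OA r] lt by auto
  show "column_square A i j l (A $$ (r, i)) (A $$ (r, j)) = A $$ (r, l)"
    using column_square_eq[OF OA _ _ _ r] lt by auto
qed

text \<open>On the rows with a fixed symbol in column \<open>m\<close>, passing from column
  \<open>i\<close> to \<open>j\<close> and then to \<open>l\<close> is the same as passing from
  \<open>i\<close> to \<open>l\<close>; signs are multiplicative.\<close>

lemma symbol_sign_cocycle:
  assumes OA: "orthogonal_array \<Lambda> k n A" and h: "inj_on h \<Lambda>"
    and lt: "i < j" "j < l" "l < m" "m < k"
  shows "symbol_sign h \<Lambda> (column_square A i l m) =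
    symbol_sign h \<Lambda> (column_square A j l m) * symbol_sign h \<Lambda> (column_square A i j m)"
proof -
  have fin: "finite \<Lambda>" and d: "dim_col A = k" using OA by (auto simp: orthogonal_array_def)
  have lat: "latin_square \<Lambda> (column_square A j l m)" "latin_square \<Lambda> (column_square A i j m)"
    using lt d by (intro latin_square_ensemble[OF OA]; force simp: ensemble_def)+
  have "perm_sign h \<Lambda> (\<lambda>x. inv_into \<Lambda> (column_square A i l m x) z) =
      perm_sign h \<Lambda> (\<lambda>x. inv_into \<Lambda> (column_square A j l m x) z) *
      perm_sign h \<Lambda> (\<lambda>x. inv_into \<Lambda> (column_square A i j m x) z)" if z: "z \<in> \<Lambda>" for z
    unfolding perm_sign_comp[OF fin h latin_square_symbol_bij[OF fin lat(2) z]
        latin_square_symbol_bij[OF fin lat(1) z], symmetric]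
  proof (rule perm_sign_cong)
    fix x assume "x \<in> \<Lambda>"
    then obtain r where r: "r < n\<^sup>2" "A $$ (r, i) = x" "A $$ (r, m) = z"
      using orthogonal_array_ex1[OF OA, of i m x z] lt z by auto
    show "inv_into \<Lambda> (column_square A i l m x) z =
        inv_into \<Lambda> (column_square A j l m (inv_into \<Lambda> (column_square A i j m x) z)) z"
      using column_square_inv[OF OA _ _ _ r(1), of i l m] column_square_inv[OF OA _ _ _ r(1), of j l m]
        column_square_inv[OF OA _ _ _ r(1), of i j m] lt r by simp
  qed
  then show ?thesis
    unfolding symbol_sign_def prod.distrib[symmetric] by (rule prod.cong[OF refl])
qed

section \<open>Pairs of distinct elements\<close>

lemma off_diagonal_ordered_pairs:
  assumes "inj_on h \<Lambda>"
  shows "{(x, y) \<in> \<Lambda> \<times> \<Lambda>. x \<noteq> y} = ordered_pairs h \<Lambda> \<union> prod.swap ` ordered_pairs h \<Lambda>"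
    and "ordered_pairs h \<Lambda> \<inter> prod.swap ` ordered_pairs h \<Lambda> = {}"
proof -
  have "x = y" if "x \<in> \<Lambda>" "y \<in> \<Lambda>" "\<not> h x < h y" "\<not> h y < h x" for x y
    using that assms by (auto simp: inj_on_def)
  then show "{(x, y) \<in> \<Lambda> \<times> \<Lambda>. x \<noteq> y} = ordered_pairs h \<Lambda> \<union> prod.swap ` ordered_pairs h \<Lambda>"
    by (force simp: ordered_pairs_def image_iff)
qed (auto simp: ordered_pairs_def)

lemma card_off_diagonal:
  assumes "finite \<Lambda>"
  shows "card {(x, y) \<in> \<Lambda> \<times> \<Lambda>. x \<noteq> y} = card \<Lambda> * (card \<Lambda> - 1)"
proof -
  have "{(x, y) \<in> \<Lambda> \<times> \<Lambda>. x \<noteq> y} = (SIGMA x:\<Lambda>. \<Lambda> - {x})" by auto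
  then show ?thesis using assms by (simp add: card_Diff_singleton)
qed

lemma card_ordered_pairs:
  assumes "finite \<Lambda>" "inj_on h \<Lambda>"
  shows "2 * card (ordered_pairs h \<Lambda>) = card \<Lambda> * (card \<Lambda> - 1)"
proof -
  have "card (prod.swap ` ordered_pairs h \<Lambda>) = card (ordered_pairs h \<Lambda>)"
    by (rule card_image) (auto simp: inj_on_def)
  then show ?thesis
    unfolding card_off_diagonal[OF assms(1), symmetric] off_diagonal_ordered_pairs(1)[OF assms(2)]
    using finite_ordered_pairs[OF assms(1), of h] off_diagonal_ordered_pairs(2)[OF assms(2)]
    by (simp add: card_Un_disjoint)
qed

text \<open>Each unordered pair occurs in both orders, once with factor 1 and once with factor
  -1.\<close>

lemma prod_off_diagonal_sgn:
  assumes fin: "finite \<Lambda>" and h: "inj_on h \<Lambda>"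
  shows "(\<Prod>(x, y)\<in>{(x, y) \<in> \<Lambda> \<times> \<Lambda>. x \<noteq> y}. sgn (h y - h x)) = (-1) ^ card (ordered_pairs h \<Lambda>)"
proof -
  let ?P = "ordered_pairs h \<Lambda>"
  have "(\<Prod>(x, y)\<in>prod.swap ` ?P. sgn (h y - h x)) = (\<Prod>(x, y)\<in>?P. sgn (h x - h y))"
    by (subst prod.reindex) (simp_all add: case_prod_unfold)
  also have "\<dots> = (\<Prod>q\<in>?P. -1)"
    by (rule prod.cong) (auto simp: ordered_pairs_def)
  finally have "(\<Prod>(x, y)\<in>prod.swap ` ?P. sgn (h y - h x)) = (-1) ^ card ?P"
    by simp
  moreover have "(\<Prod>(x, y)\<in>?P. sgn (h y - h x)) = 1"
    by (rule prod.neutral) (auto simp: ordered_pairs_def)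
  ultimately show ?thesis
    unfolding off_diagonal_ordered_pairs(1)[OF h]
    using finite_ordered_pairs[OF fin, of h] off_diagonal_ordered_pairs(2)[OF h]
    by (simp add: prod.union_disjoint)
qed

section \<open>Complete arrays\<close>

text \<open>\<open>(l, z)\<close> selects the row with \<open>x\<close> and the row with
  \<open>x'\<close> in column 0 that both have \<open>z\<close> in column \<open>l\<close>; its
  image is their pair of entries in column 1. Distinct rows agree in at most one column, which gives
  injectivity, and counting gives the rest.\<close>

lemma complete_array_bij:
  assumes OA: "orthogonal_array \<Lambda> (n + 1) n A" and n: "n \<ge> 2"
    and x: "x \<in> \<Lambda>" and x': "x' \<in> \<Lambda>" and neq: "x \<noteq> x'"
  shows "bij_betw (\<lambda>(l, z). (inv_into \<Lambda> (column_square A 0 1 l x) z,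
      inv_into \<Lambda> (column_square A 0 1 l x') z)) ({2..n} \<times> \<Lambda>) {(y, y') \<in> \<Lambda> \<times> \<Lambda>. y \<noteq> y'}"
    (is "bij_betw ?f ?D ?R")
proof -
  have fin: "finite \<Lambda>" and card: "card \<Lambda> = n" using OA by (auto simp: orthogonal_array_def)
  have row: "\<exists>r<n\<^sup>2. A $$ (r, 0) = u \<and> A $$ (r, l) = z \<and>
      inv_into \<Lambda> (column_square A 0 1 l u) z = A $$ (r, 1)"
    if uz: "u \<in> \<Lambda>" "z \<in> \<Lambda>" "l \<in> {2..n}" for u z l
  proof -
    obtain r where r: "r < n\<^sup>2" "A $$ (r, 0) = u" "A $$ (r, l) = z"
      using orthogonal_array_ex1[OF OA, of 0 l u z] uz by auto
    then show ?thesis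
      using column_square_inv[OF OA, of 0 1 l r] uz by auto
  qed
  have into: "?f ` ?D \<subseteq> ?R"
  proof
    fix p assume "p \<in> ?f ` ?D"
    then obtain l z where lz: "l \<in> {2..n}" "z \<in> \<Lambda>" and p: "p = ?f (l, z)"
      by (elim imageE SigmaE) simp
    obtain r where r: "r < n\<^sup>2" "A $$ (r, 0) = x" "A $$ (r, l) = z"
      "inv_into \<Lambda> (column_square A 0 1 l x) z = A $$ (r, 1)" using row[OF x lz(2,1)] by blast
    obtain s where s: "s < n\<^sup>2" "A $$ (s, 0) = x'" "A $$ (s, l) = z"
      "inv_into \<Lambda> (column_square A 0 1 l x') z = A $$ (s, 1)" using row[OF x' lz(2,1)] by blast
    \<comment> \<open>The two rows already agree in column \<open>l\<close>; a second agreement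
      would identify them, against \<open>x \<noteq> x'\<close>.\<close>
    have "A $$ (r, 1) \<noteq> A $$ (s, 1)"
      using orthogonal_array_row_eq[OF OA _ _ _ r(1) s(1), of l 1] r(2,3) s(2,3) lz n neq by force
    moreover have "A $$ (r, 1) \<in> \<Lambda>" "A $$ (s, 1) \<in> \<Lambda>"
      using orthogonal_array_entry[OF OA] r(1) s(1) n by simp_all
    ultimately show "p \<in> ?R" using p r(4) s(4) by simp
  qed
  have inj: "inj_on ?f ?D"
  proof (rule inj_onI)
    fix p q assume pq: "p \<in> ?D" "q \<in> ?D" and eq: "?f p = ?f q"
    obtain l z where lz: "l \<in> {2..n}" "z \<in> \<Lambda>" and p: "p = (l, z)" using pq(1) by auto
    obtain l' z' where lz': "l' \<in> {2..n}" "z' \<in> \<Lambda>" and q: "q = (l', z')" using pq(2) by auto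
    obtain r where r: "r < n\<^sup>2" "A $$ (r, 0) = x" "A $$ (r, l) = z"
      "inv_into \<Lambda> (column_square A 0 1 l x) z = A $$ (r, 1)" using row[OF x lz(2,1)] by blast
    obtain s where s: "s < n\<^sup>2" "A $$ (s, 0) = x'" "A $$ (s, l) = z"
      "inv_into \<Lambda> (column_square A 0 1 l x') z = A $$ (s, 1)" using row[OF x' lz(2,1)] by blast
    obtain r' where r': "r' < n\<^sup>2" "A $$ (r', 0) = x" "A $$ (r', l') = z'"
      "inv_into \<Lambda> (column_square A 0 1 l' x) z' = A $$ (r', 1)" using row[OF x lz'(2,1)] by blast
    obtain s' where s': "s' < n\<^sup>2" "A $$ (s', 0) = x'" "A $$ (s', l') = z'"
      "inv_into \<Lambda> (column_square A 0 1 l' x') z' = A $$ (s', 1)" using row[OF x' lz'(2,1)] by blast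
    \<comment> \<open>Rows are determined by columns 0 and 1, so \<open>(l, z)\<close> and
      \<open>(l', z')\<close> select the same two rows. These then agree in both \<open>l\<close>
      and \<open>l'\<close>.\<close>
    have "A $$ (r, 1) = A $$ (r', 1)" "A $$ (s, 1) = A $$ (s', 1)"
      using eq unfolding p q by (simp_all add: r(4) s(4) r'(4) s'(4) del: One_nat_def)
    then have rr: "r' = r" and ss: "s' = s"
      using orthogonal_array_row_eq[OF OA _ _ _ r'(1) r(1), of 0 1]
        orthogonal_array_row_eq[OF OA _ _ _ s'(1) s(1), of 0 1] r(2) s(2) r'(2) s'(2) n by simp_all
    have "r \<noteq> s" using r(2) s(2) neq by auto
    then have "l = l'"
      using orthogonal_array_row_eq[OF OA _ _ _ r(1) s(1), of l l'] r(3) s(3) r'(3) s'(3) rr ss lz lz'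
      by force
    then show "p = q" using p q r(3) r'(3) rr by simp
  qed
  \<comment> \<open>Completeness enters here: \<open>n + 1\<close> columns leave
    \<open>n - 1\<close> values of \<open>l\<close>, hence \<open>n * (n - 1)\<close> pairs on both
    sides.\<close>
  have "card ?D = card ?R"
    using card_off_diagonal[OF fin] card n by (simp add: card_cartesian_product)
  moreover have "finite ?R"
    using fin by (auto intro: finite_subset[of _ "\<Lambda> \<times> \<Lambda>"])
  ultimately have "?f ` ?D = ?R"
    using card_image[OF inj] card_subset_eq[OF _ into] by simp
  then show ?thesis using inj by (simp add: bij_betw_def)
qed

text \<open>Exchange the products and fix a pair from column 0. As \<open>l\<close> and
  \<open>z\<close> vary, the bijection above runs through all pairs of distinct entries of column 1,
  contributing \<open>(-1) ^ m\<close>; there are \<open>m\<close> pairs to fix.\<close>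

lemma prod_symbol_sign_complete:
  assumes OA: "orthogonal_array \<Lambda> (n + 1) n A" and n: "n \<ge> 2" and h: "inj_on h \<Lambda>"
  defines "m \<equiv> card (ordered_pairs h \<Lambda>)"
  shows "(\<Prod>l\<in>{2..n}. symbol_sign h \<Lambda> (column_square A 0 1 l)) = (-1) ^ (m * m)"
proof -
  have fin: "finite \<Lambda>" using OA by (simp add: orthogonal_array_def)
  let ?s = "\<lambda>l z x. inv_into \<Lambda> (column_square A 0 1 l x) z"
  let ?g = "\<lambda>(y, y'). sgn (h y' - h y)"
  have "(\<Prod>l\<in>{2..n}. symbol_sign h \<Lambda> (column_square A 0 1 l)) =
      (\<Prod>(l, z)\<in>{2..n} \<times> \<Lambda>. perm_sign h \<Lambda> (?s l z))"
    unfolding symbol_sign_def by (rule prod.cartesian_product)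
  also have "\<dots> = (\<Prod>q\<in>ordered_pairs h \<Lambda>. \<Prod>p\<in>{2..n} \<times> \<Lambda>.
      sgn (h (?s (fst p) (snd p) (snd q)) - h (?s (fst p) (snd p) (fst q))))"
    unfolding perm_sign_def case_prod_unfold by (rule prod.swap)
  also have "\<dots> = (\<Prod>q\<in>ordered_pairs h \<Lambda>. (-1) ^ m)"
  proof (rule prod.cong[OF refl])
    fix q assume q: "q \<in> ordered_pairs h \<Lambda>"
    have "fst q \<in> \<Lambda>" "snd q \<in> \<Lambda>" "fst q \<noteq> snd q"
      using q by (auto simp: ordered_pairs_def)
    from prod.reindex_bij_betw[OF complete_array_bij[OF OA n this], of ?g]
    show "(\<Prod>p\<in>{2..n} \<times> \<Lambda>. sgn (h (?s (fst p) (snd p) (snd q)) - h (?s (fst p) (snd p) (fst q)))) =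
        (-1) ^ m"
      unfolding prod_off_diagonal_sgn[OF fin h] m_def by (simp add: case_prod_unfold)
  qed
  also have "\<dots> = (-1) ^ (m * m)"
    by (simp add: m_def power_mult)
  finally show ?thesis .
qed

section \<open>Contradiction from a constant invariant\<close>

theorem corollary6p11:
  fixes n :: nat and \<Lambda> :: "'a set" and A :: "'a mat"
  assumes "[n = 2] (mod 4)" and "n > 2"
    and "orthogonal_array \<Lambda> (n + 1) n A"
  shows "\<exists>L\<in>ensemble A. \<exists>M\<in>ensemble A.
           latin_square \<Lambda> L \<and> latin_square \<Lambda> M \<and> \<not> isotopic \<Lambda> L M"
proof (rule ccontr)
  note OA = assms(3)
  assume none: "\<not> ?thesis"
  have fin: "finite \<Lambda>" and card: "card \<Lambda> = n" and d: "dim_col A = n + 1"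
    using OA by (auto simp: orthogonal_array_def)
  obtain h0 :: "'a \<Rightarrow> nat" where "inj_on h0 \<Lambda>"
    using finite_imp_inj_to_nat_seg[OF fin] by blast
  \<comment> \<open>Integer values are used because the differences inside \<open>sgn\<close> may be
    negative.\<close>
  moreover define h where "h x = int (h0 x)" for x
  ultimately have h: "inj_on h \<Lambda>" by (auto simp: inj_on_def)
  have "n mod 4 = 2" using assms(1) by (simp add: cong_def)
  then obtain t where t: "n = 4 * t + 2"
    by (metis mult_div_mod_eq)
  have mem: "column_square A i j l \<in> ensemble A" if "i < j" "j < l" "l \<le> n" for i j l
    unfolding ensemble_def mem_Collect_eq using that d
    by (intro exI[of _ i] exI[of _ j] exI[of _ l]) simp
  define c where "c = symbol_sign h \<Lambda> (column_square A 0 1 2)"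
  have c: "symbol_sign h \<Lambda> (column_square A i j l) = c" if ijl: "i < j" "j < l" "l \<le> n" for i j l
  proof -
    have e: "column_square A 0 1 2 \<in> ensemble A" "column_square A i j l \<in> ensemble A"
      using mem ijl assms(2) by auto
    note lat = latin_square_ensemble[OF OA e(1)] latin_square_ensemble[OF OA e(2)]
    \<comment> \<open>All squares of the ensemble are Latin, so the negated claim makes any two of
      them isotopic.\<close>
    have "isotopic \<Lambda> (column_square A 0 1 2) (column_square A i j l)"
      using none e lat by blast
    then show ?thesis
      unfolding c_def using t card by (intro symbol_sign_isotopic[OF fin h _ lat]) auto
  qed
  have "c = c * c"
  proof -
    \<comment> \<open>Column 3 exists because \<open>n > 2\<close>.\<close>
    have "symbol_sign h \<Lambda> (column_square A 0 2 3) = c"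
      "symbol_sign h \<Lambda> (column_square A 1 2 3) = c" "symbol_sign h \<Lambda> (column_square A 0 1 3) = c"
      using assms(2) by (intro c; simp)+
    then show ?thesis
      using symbol_sign_cocycle[OF OA h, of 0 1 2 3] assms(2) by simp
  qed
  moreover have "c * c = 1"
    unfolding c_def using assms(2)
    by (intro symbol_sign_square[OF fin h] latin_square_ensemble[OF OA] mem) auto
  ultimately have c1: "c = 1" by simp
  \<comment> \<open>This is \<open>n * (n - 1) div 2\<close> for \<open>n = 4 * t + 2\<close>, a
    product of two odd numbers. Its square is odd too, so the product over \<open>l\<close> would be
    both 1 and -1.\<close>
  have "card (ordered_pairs h \<Lambda>) = (2 * t + 1) * (4 * t + 1)"
    using card_ordered_pairs[OF fin h] card t by simp
  then have "odd (card (ordered_pairs h \<Lambda>))" by simp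
  moreover have "(\<Prod>l\<in>{2..n}. symbol_sign h \<Lambda> (column_square A 0 1 l)) = 1"
    using c[of 0 1] c1 by (intro prod.neutral) auto
  ultimately show False
    using prod_symbol_sign_complete[OF OA _ h] assms(2) by simp
qed

end
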